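(* Let $I\subseteq\mathbb{R}$ be an interval and let $E,F\colon I\times I\to\mathbb{R}$ be normalizable semideviations with normalizations $E^*,F^*$. If $E^*\le F^*$ on $I\times I$, then $$\underline{\underline{\mathcal{D}}}_E\le\underline{\underline{\mathcal{D}}}_F,\qquad\underline{\mathcal{D}}_E\le\underline{\mathcal{D}}_F,\qquad\overline{\mathcal{D}}_E\le\overline{\mathcal{D}}_F,\qquad\overline{\overline{\mathcal{D}}}_E\le\overline{\overline{\mathcal{D}}}_F$$ on $\bigcup_{n=1}^\infty I^n\times W_n(\mathbb{R})$. Conversely, if $$\underline{\underline{\mathcal{D}}}_E\le\overline{\overline{\mathcal{D}}}_F$$ on $\bigcup_{n=1}^\infty I^n\times W_n(\mathbb{R})$, then $E^*\le F^*$ on $I\times I$. Therefore the inequality $E^*\le F^*$ is also necessary for any one of the four inequalities displayed first.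
   Context: For $n\in\mathbb{N}$, $W_n(\mathbb{R})=\{(\lambda_1,\dots,\lambda_n)\in\mathbb{R}^n\mid\lambda_i\ge0\ \forall i,\ \lambda_1+\dots+\lambda_n>0\}$. A function $E\colon I\times I\to\mathbb{R}$ is a semideviation if for all distinct $x,y\in I$ the sign of $E(x,y)$ equals the sign of $x-y$. For $(x,\lambda)\in I^n\times W_n(\mathbb{R})$ let $e(y)=\lambda_1E(x_1,y)+\cdots+\lambda_nE(x_n,y)$, $y\in I$, and define $\underline{\underline{\mathcal{D}}}_E(x,\lambda)=\inf\{y\in I\mid e(y)\le0\}$, $\ \overline{\overline{\mathcal{D}}}_E(x,\lambda)=\sup\{y\in I\mid e(y)\ge0\}$, $\underline{\mathcal{D}}_E(x,\lambda)=\inf\{y\in I\mid e(y)<0\}$, $\ \overline{\mathcal{D}}_E(x,\lambda)=\sup\{y\in I\mid e(y)>0\}$. Equivalently, $\underline{\underline{\mathcal{D}}}_E(x,\lambda)=\sup\{y\in I: e|_{(-\infty,y)\cap I}>0\}$, $\overline{\overline{\mathcal{D}}}_E(x,\lambda)=\inf\{y\in I: e|_{(y,\infty)\cap I}<0\}$, $\underline{\mathcal{D}}_E(x,\lambda)=\sup\{y\in I: e|_{(-\infty,y)\cap I}\ge0\}$, $\overline{\mathcal{D}}_E(x,\lambda)=\inf\{y\in I: e|_{(y,\infty)\cap I}\le0\}$ (this second description is the one used if a set in the first description is empty, which can only happen when $I$ contains an endpoint). A semideviation $E\colon I\times I\to\mathbb{R}$ is normalizable if (a) for all $x\in I$ the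 function $y\mapsto E(x,y)$ is continuous on $I$; (b) for all $x\in I$ the function $y\mapsto E(x,y)$ is differentiable at $y=x$ (with derivative $\partial_2E(x,x)$); (c) $x\mapsto\partial_2E(x,x)$ is strictly negative and continuous on $I$. For a normalizable semideviation, $E(x,x)=0$ for all $x\in I$ (this is automatic when $x$ is an interior point of $I$, and is taken as part of the definition at endpoints belonging to $I$). Its normalization is $E^*(x,y)=\dfrac{E(x,y)}{-\partial_2E(y,y)}$, $x,y\in I$. *)

theory Defs
  imports "HOL-Analysis.Analysis"
begin

text \<open>
  A function on $I \times I$ is a curried function on all reals; its values outside
  $I \times I$ never matter. Vectors of varying dimension $n$ are lists of length $n$.
\<close>

definition weights :: "nat \<Rightarrow> real list set" where
  "weights n = {l. length l = n \<and> (\<forall>i<n. l ! i \<ge> 0) \<and> (\<Sum>i<n. l ! i) > 0}"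

definition weighted_samples :: "real set \<Rightarrow> (real list \<times> real list) set" where
  "weighted_samples I = (\<Union>n\<in>{1..}. {x. length x = n \<and> set x \<subseteq> I} \<times> weights n)"

definition semideviation :: "real set \<Rightarrow> (real \<Rightarrow> real \<Rightarrow> real) \<Rightarrow> bool" where
  "semideviation I E \<longleftrightarrow> (\<forall>x\<in>I. \<forall>y\<in>I. x \<noteq> y \<longrightarrow> sgn (E x y) = sgn (x - y))"

definition weighted_dev ::
  "(real \<Rightarrow> real \<Rightarrow> real) \<Rightarrow> real list \<Rightarrow> real list \<Rightarrow> real \<Rightarrow> real" where
  "weighted_dev E x l y = (\<Sum>i<length x. l ! i * E (x ! i) y)"

text \<open>
  In each of the four definitions below the second description replaces the first one
  when the set of the first one is empty (possible only if $I$ contains an endpoint).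
  Whenever both apply, they agree.
\<close>

definition D_lower_lower ::
  "real set \<Rightarrow> (real \<Rightarrow> real \<Rightarrow> real) \<Rightarrow> real list \<Rightarrow> real list \<Rightarrow> real" where
  "D_lower_lower I E x l =
    (if {y\<in>I. weighted_dev E x l y \<le> 0} \<noteq> {}
     then Inf {y\<in>I. weighted_dev E x l y \<le> 0}
     else Sup {y\<in>I. \<forall>z\<in>{..<y} \<inter> I. weighted_dev E x l z > 0})"

definition D_lower ::
  "real set \<Rightarrow> (real \<Rightarrow> real \<Rightarrow> real) \<Rightarrow> real list \<Rightarrow> real list \<Rightarrow> real" where
  "D_lower I E x l =
    (if {y\<in>I. weighted_dev E x l y < 0} \<noteq> {}
     then Inf {y\<in>I. weighted_dev E x l y < 0}
     else Sup {y\<in>I. \<forall>z\<in>{..<y} \<inter> I. weighted_dev E x l z \<ge> 0})"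

definition D_upper ::
  "real set \<Rightarrow> (real \<Rightarrow> real \<Rightarrow> real) \<Rightarrow> real list \<Rightarrow> real list \<Rightarrow> real" where
  "D_upper I E x l =
    (if {y\<in>I. weighted_dev E x l y > 0} \<noteq> {}
     then Sup {y\<in>I. weighted_dev E x l y > 0}
     else Inf {y\<in>I. \<forall>z\<in>{y<..} \<inter> I. weighted_dev E x l z \<le> 0})"

definition D_upper_upper ::
  "real set \<Rightarrow> (real \<Rightarrow> real \<Rightarrow> real) \<Rightarrow> real list \<Rightarrow> real list \<Rightarrow> real" where
  "D_upper_upper I E x l =
    (if {y\<in>I. weighted_dev E x l y \<ge> 0} \<noteq> {}
     then Sup {y\<in>I. weighted_dev E x l y \<ge> 0}
     else Inf {y\<in>I. \<forall>z\<in>{y<..} \<inter> I. weighted_dev E x l z < 0})"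

text \<open>
  The derivative is taken relative to $I$, hence one-sided at an endpoint belonging to $I$.
  If $I$ is a single point, it is an unspecified number.
\<close>

definition partial2_diag :: "real set \<Rightarrow> (real \<Rightarrow> real \<Rightarrow> real) \<Rightarrow> real \<Rightarrow> real" where
  "partial2_diag I E x = vector_derivative (\<lambda>y. E x y) (at x within I)"

text \<open>
  The condition $E(x,x) = 0$ is imposed only at the endpoints of $I$ belonging to $I$:
  at interior points it follows from the sign condition and continuity.
\<close>

definition normalizable :: "real set \<Rightarrow> (real \<Rightarrow> real \<Rightarrow> real) \<Rightarrow> bool" where
  "normalizable I E \<longleftrightarrow>
     semideviation I E \<and>
     (\<forall>x\<in>I. continuous_on I (\<lambda>y. E x y)) \<and>
     (\<forall>x\<in>I. (\<lambda>y. E x y) differentiable (at x within I)) \<and>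
     (\<forall>x\<in>I. partial2_diag I E x < 0) \<and>
     continuous_on I (partial2_diag I E) \<and>
     (\<forall>x\<in>I - interior I. E x x = 0)"

definition normalization :: "real set \<Rightarrow> (real \<Rightarrow> real \<Rightarrow> real) \<Rightarrow> real \<Rightarrow> real \<Rightarrow> real" where
  "normalization I E x y = E x y / (- partial2_diag I E y)"

end

theory Submission
  imports Defs
begin

text \<open>
  If $E^* \le F^*$, then $e_E(y) / (-\partial_2 E(y,y)) \le e_F(y) / (-\partial_2 F(y,y))$, which
  nests the level sets whose infima and suprema are compared. Conversely, for the two-point
  sample $(x, y)$ with weights $(t, 1)$, all four deviation means equal $y + t E^*(x,y) + o(t)$
  as $t \downarrow 0$, so $E^*(x,y) > F^*(x,y)$ would separate the means of $E$ and $F$ in the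
  wrong order.
\<close>

section \<open>Signs of the weighted deviation of one sample\<close>

text \<open>Vanishing on the diagonal is assumed directly as \<open>diag\<close>; for normalizable
  semideviations \<open>normalizable_diag\<close> supplies it.\<close>

locale sample =
  fixes I :: "real set" and E :: "real \<Rightarrow> real \<Rightarrow> real" and x l :: "real list"
  assumes interval: "is_interval I"
    and semidev: "semideviation I E"
    and diag: "\<And>p. p \<in> I \<Longrightarrow> E p p = 0"
    and sample: "(x, l) \<in> weighted_samples I"
begin

abbreviation e :: "real \<Rightarrow> real" where
  "e \<equiv> weighted_dev E x l"

lemma nonempty: "x \<noteq> []" and points: "set x \<subseteq> I"
  and weight_nonneg: "i < length x \<Longrightarrow> l ! i \<ge> 0"
  and weight_sum: "(\<Sum>i<length x. l ! i) > 0"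
  using sample by (auto simp: weighted_samples_def weights_def)

lemma dev_pos: "\<lbrakk>p \<in> I; q \<in> I; q < p\<rbrakk> \<Longrightarrow> E p q > 0"
  and dev_neg: "\<lbrakk>p \<in> I; q \<in> I; q > p\<rbrakk> \<Longrightarrow> E p q < 0"
  using semidev by (fastforce simp: semideviation_def sgn_if split: if_splits)+

lemma ex_weight_pos: "\<exists>i<length x. l ! i > 0"
proof (rule ccontr)
  assume "\<not> ?thesis"
  then have "(\<Sum>i<length x. l ! i) \<le> 0"
    by (intro sum_nonpos) force
  with weight_sum show False by simp
qed

lemma Min_in: "Min (set x) \<in> I" and Max_in: "Max (set x) \<in> I"
  using points nonempty by (meson List.finite_set Min_in Max_in set_empty subsetD)+

lemma nth_in: "i < length x \<Longrightarrow> x ! i \<in> I"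
  and nth_ge: "i < length x \<Longrightarrow> Min (set x) \<le> x ! i"
  and nth_le: "i < length x \<Longrightarrow> x ! i \<le> Max (set x)"
  using points by auto

text \<open>To the left of the whole sample every deviation is positive, and
  \<open>ex_weight_pos\<close> makes at least one summand strictly positive.\<close>

lemma e_pos:
  assumes "y \<in> I" "y < Min (set x)"
  shows "e y > 0"
proof -
  have "E (x ! i) y > 0" if "i < length x" for i
    using dev_pos[OF nth_in[OF that] assms(1)] nth_ge[OF that] assms(2) by simp
  then show ?thesis
    unfolding weighted_dev_def using ex_weight_pos weight_nonneg
    by (elim exE conjE, intro sum_pos2[of "{..<length x}"] mult_pos_pos mult_nonneg_nonneg)
      (auto intro: less_imp_le)
qed

lemma e_neg:
  assumes "y \<in> I" "y > Max (set x)"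
  shows "e y < 0"
proof -
  have "E (x ! i) y < 0" if "i < length x" for i
    using dev_neg[OF nth_in[OF that] assms(1)] nth_le[OF that] assms(2) by simp
  then have "(\<Sum>i<length x. l ! i * - E (x ! i) y) > 0"
    using ex_weight_pos weight_nonneg
    by (elim exE conjE, intro sum_pos2[of "{..<length x}"] mult_pos_pos mult_nonneg_nonneg)
      (auto intro: less_imp_le)
  then show ?thesis
    by (simp add: weighted_dev_def sum_negf)
qed

text \<open>Sample points above the minimum contribute nonnegative terms, and those equal to it
  contribute 0 by \<open>diag\<close>. With \<open>e_Max\<close> this makes the sets with nonstrict
  inequalities nonempty, so the two outer means always use their first description.\<close>

lemma e_Min: "e (Min (set x)) \<ge> 0"
  unfolding weighted_dev_def
proof (intro sum_nonneg mult_nonneg_nonneg)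
  fix i assume "i \<in> {..<length x}"
  then show "l ! i \<ge> 0" "E (x ! i) (Min (set x)) \<ge> 0"
    using weight_nonneg dev_pos[OF nth_in Min_in, of i] nth_ge[of i] diag[OF Min_in]
    by (cases "x ! i = Min (set x)"; auto simp: less_le)+
qed

lemma e_Max: "e (Max (set x)) \<le> 0"
  unfolding weighted_dev_def
proof (intro sum_nonpos mult_nonneg_nonpos)
  fix i assume "i \<in> {..<length x}"
  then show "l ! i \<ge> 0" "E (x ! i) (Max (set x)) \<le> 0"
    using weight_nonneg dev_neg[OF nth_in Max_in, of i] nth_le[of i] diag[OF Max_in]
    by (cases "x ! i = Max (set x)"; auto simp: less_le)+
qed

section \<open>The four means as infima, suprema or endpoints\<close>

lemma bdd_below_nonpos: "bdd_below {y\<in>I. e y \<le> 0}"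
  by (rule bdd_belowI[of _ "Min (set x)"]) (use e_pos in force)

lemma bdd_below_neg: "bdd_below {y\<in>I. e y < 0}"
  by (rule bdd_below_mono[OF bdd_below_nonpos]) auto

lemma bdd_above_nonneg: "bdd_above {y\<in>I. e y \<ge> 0}"
  by (rule bdd_aboveI[of _ "Max (set x)"]) (use e_neg in force)

lemma bdd_above_pos: "bdd_above {y\<in>I. e y > 0}"
  by (rule bdd_above_mono[OF bdd_above_nonneg]) auto

lemma D_lower_lower_eq: "D_lower_lower I E x l = Inf {y\<in>I. e y \<le> 0}"
  using e_Max Max_in by (auto simp: D_lower_lower_def)

lemma D_upper_upper_eq: "D_upper_upper I E x l = Sup {y\<in>I. e y \<ge> 0}"
  using e_Min Min_in by (auto simp: D_upper_upper_def)

lemma le_Max: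
  assumes "{y\<in>I. e y < 0} = {}" "y \<in> I"
  shows "y \<le> Max (set x)"
  using assms e_neg[OF assms(2)] not_le by blast

lemma Min_le:
  assumes "{y\<in>I. e y > 0} = {}" "y \<in> I"
  shows "Min (set x) \<le> y"
  using assms e_pos[OF assms(2)] not_le by blast

text \<open>If \<open>e\<close> is never negative, \<open>e_neg\<close> leaves no point of
  \<open>I\<close> above the sample, so the largest sample point is the right endpoint of
  \<open>I\<close>. The second description then ranges over all of \<open>I\<close> and returns this
  endpoint.\<close>

lemma D_lower_eq_Max:
  assumes "{y\<in>I. e y < 0} = {}"
  shows "D_lower I E x l = Max (set x)"
proof -
  have "{y\<in>I. \<forall>z\<in>{..<y} \<inter> I. e z \<ge> 0} = I"
    using assms by force
  moreover have "Sup I = Max (set x)"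
    using le_Max[OF assms] Max_in by (intro cSup_eq_maximum)
  ultimately show ?thesis
    by (simp add: D_lower_def assms del: Collect_empty_eq)
qed

lemma D_upper_eq_Min:
  assumes "{y\<in>I. e y > 0} = {}"
  shows "D_upper I E x l = Min (set x)"
proof -
  have "{y\<in>I. \<forall>z\<in>{y<..} \<inter> I. e z \<le> 0} = I"
    using assms by force
  moreover have "Inf I = Min (set x)"
    using Min_le[OF assms] Min_in by (intro cInf_eq_minimum)
  ultimately show ?thesis
    by (simp add: D_upper_def assms del: Collect_empty_eq)
qed

lemma D_lower_eq_Inf:
  "{y\<in>I. e y < 0} \<noteq> {} \<Longrightarrow> D_lower I E x l = Inf {y\<in>I. e y < 0}"
  by (simp only: D_lower_def if_True simp_thms)

lemma D_upper_eq_Sup: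
  "{y\<in>I. e y > 0} \<noteq> {} \<Longrightarrow> D_upper I E x l = Sup {y\<in>I. e y > 0}"
  by (simp only: D_upper_def if_True simp_thms)

section \<open>Order among the four means of one sample\<close>

text \<open>A number strictly between \<open>Sup B\<close> and \<open>Inf A\<close> would lie
  between a point of \<open>B\<close> and a point of \<open>A\<close>, hence in the interval
  \<open>I\<close>, yet in neither of the two sets covering \<open>I\<close>.\<close>

lemma Inf_le_Sup:
  assumes "A \<subseteq> I" "B \<subseteq> I" "A \<noteq> {}" "B \<noteq> {}" "bdd_below A" "bdd_above B" "I \<subseteq> A \<union> B"
  shows "Inf A \<le> Sup B"
proof (rule ccontr)
  assume "\<not> ?thesis"
  then obtain w where w: "Sup B < w" "w < Inf A"
    using dense not_le by blast
  obtain a b where ab: "a \<in> A" "b \<in> B"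
    using assms by blast
  have "b \<le> w" "w \<le> a"
    using w cSup_upper[OF ab(2) assms(6)] cInf_lower[OF ab(1) assms(5)] by auto
  then have "w \<in> I"
    using interval ab assms(1,2) by (meson mem_is_interval_1_I subsetD)
  then show False
    using w cSup_upper[OF _ assms(6), of w] cInf_lower[OF _ assms(5), of w] assms(7) by force
qed

text \<open>The infimum over the larger set is smaller. If the smaller set is empty, the endpoint
  \<open>Max (set x)\<close> replacing its infimum still belongs to the larger set by
  \<open>e_Max\<close>.\<close>

lemma D_lower_lower_le_D_lower: "D_lower_lower I E x l \<le> D_lower I E x l"
proof (cases "{y\<in>I. e y < 0} = {}")
  case True
  show ?thesis
    unfolding D_lower_lower_eq D_lower_eq_Max[OF True]
    using e_Max Max_in by (intro cInf_lower bdd_below_nonpos) auto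
next
  case False
  then show ?thesis
    unfolding D_lower_lower_eq D_lower_eq_Inf[OF False]
    by (intro cInf_superset_mono bdd_below_nonpos) auto
qed

lemma D_upper_le_D_upper_upper: "D_upper I E x l \<le> D_upper_upper I E x l"
proof (cases "{y\<in>I. e y > 0} = {}")
  case True
  show ?thesis
    unfolding D_upper_upper_eq D_upper_eq_Min[OF True]
    using e_Min Min_in by (intro cSup_upper bdd_above_nonneg) auto
next
  case False
  then show ?thesis
    unfolding D_upper_upper_eq D_upper_eq_Sup[OF False]
    by (intro cSup_subset_mono bdd_above_nonneg) auto
qed

text \<open>The sets where \<open>e < 0\<close> and \<open>e \<ge> 0\<close> cover \<open>I\<close>,
  so \<open>Inf_le_Sup\<close> applies. If the first is empty, the left side is
  \<open>Max (set x)\<close>, which lies in the second.\<close>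

lemma D_lower_le_D_upper_upper: "D_lower I E x l \<le> D_upper_upper I E x l"
proof (cases "{y\<in>I. e y < 0} = {}")
  case True
  then have "e (Max (set x)) \<ge> 0"
    using Max_in by force
  then show ?thesis
    unfolding D_upper_upper_eq D_lower_eq_Max[OF True]
    using Max_in by (intro cSup_upper bdd_above_nonneg) auto
next
  case False
  have "{y\<in>I. e y \<ge> 0} \<noteq> {}"
    using e_Min Min_in by blast
  then show ?thesis
    unfolding D_upper_upper_eq D_lower_eq_Inf[OF False]
    using False by (intro Inf_le_Sup bdd_above_nonneg bdd_below_neg) auto
qed

lemma D_lower_lower_le_D_upper: "D_lower_lower I E x l \<le> D_upper I E x l"
proof (cases "{y\<in>I. e y > 0} = {}")
  case True
  then have "e (Min (set x)) \<le> 0"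
    using Min_in by force
  then show ?thesis
    unfolding D_lower_lower_eq D_upper_eq_Min[OF True]
    using Min_in by (intro cInf_lower bdd_below_nonpos) auto
next
  case False
  have "{y\<in>I. e y \<le> 0} \<noteq> {}"
    using e_Max Max_in by blast
  then show ?thesis
    unfolding D_lower_lower_eq D_upper_eq_Sup[OF False]
    using False by (intro Inf_le_Sup bdd_above_pos bdd_below_nonpos) auto
qed

lemma D_lower_lower_le_D_upper_upper: "D_lower_lower I E x l \<le> D_upper_upper I E x l"
  using D_lower_lower_le_D_lower D_lower_le_D_upper_upper by (rule order_trans)

text \<open>Stated for an arbitrary real \<open>v\<close>, so that it applies directly to
  \<open>v = y + t * c'\<close> in the two-point argument.\<close>

lemma D_lower_lower_ge:
  assumes "\<And>y. \<lbrakk>y \<in> I; y < v\<rbrakk> \<Longrightarrow> e y > 0"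
  shows "v \<le> D_lower_lower I E x l"
  unfolding D_lower_lower_eq
proof (rule cInf_greatest)
  show "{y\<in>I. e y \<le> 0} \<noteq> {}"
    using e_Max Max_in by blast
qed (use assms in force)

lemma D_upper_upper_le:
  assumes "\<And>y. \<lbrakk>y \<in> I; y > v\<rbrakk> \<Longrightarrow> e y < 0"
  shows "D_upper_upper I E x l \<le> v"
  unfolding D_upper_upper_eq
proof (rule cSup_least)
  show "{y\<in>I. e y \<ge> 0} \<noteq> {}"
    using e_Min Min_in by blast
qed (use assms in force)

end

section \<open>Monotonicity of the means under comparison of signs\<close>

text \<open>The means depend only on the sign of \<open>e\<close>. The two implications nest the
  level sets directly for \<open>\<le> 0\<close> and \<open>< 0\<close>, and by contraposition for
  \<open>> 0\<close> and \<open>\<ge> 0\<close>.\<close>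

locale ordered_samples = E: sample I E x l + F: sample I F x l for I E F x l +
  assumes nonpos: "\<And>y. \<lbrakk>y \<in> I; F.e y \<le> 0\<rbrakk> \<Longrightarrow> E.e y \<le> 0"
    and neg: "\<And>y. \<lbrakk>y \<in> I; F.e y < 0\<rbrakk> \<Longrightarrow> E.e y < 0"
begin

lemma D_lower_lower_mono: "D_lower_lower I E x l \<le> D_lower_lower I F x l"
  unfolding E.D_lower_lower_eq F.D_lower_lower_eq
proof (rule cInf_superset_mono)
  show "{y\<in>I. F.e y \<le> 0} \<noteq> {}"
    using F.e_Max F.Max_in by blast
qed (use E.bdd_below_nonpos nonpos in auto)

lemma D_upper_upper_mono: "D_upper_upper I E x l \<le> D_upper_upper I F x l"
  unfolding E.D_upper_upper_eq F.D_upper_upper_eq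
proof (rule cSup_subset_mono)
  show "{y\<in>I. E.e y \<ge> 0} \<noteq> {}"
    using E.e_Min E.Min_in by blast
  show "{y\<in>I. E.e y \<ge> 0} \<subseteq> {y\<in>I. F.e y \<ge> 0}"
    using neg by (force simp: not_less[symmetric])
qed (use F.bdd_above_nonneg in auto)

text \<open>If \<open>F.e\<close> is never negative, the mean of \<open>F\<close> is the right
  endpoint of \<open>I\<close>, which dominates the mean of \<open>E\<close>. Otherwise
  \<open>neg\<close> makes the set of \<open>E\<close> nonempty as well, and inclusion compares the
  infima.\<close>

lemma D_lower_mono: "D_lower I E x l \<le> D_lower I F x l"
proof (cases "{y\<in>I. F.e y < 0} = {}")
  case F: True
  show ?thesis
  proof (cases "{y\<in>I. E.e y < 0} = {}")
    case True
    then show ?thesis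
      by (simp only: E.D_lower_eq_Max F.D_lower_eq_Max[OF F] order_refl)
  next
    case False
    then obtain z where z: "z \<in> I" "E.e z < 0"
      by blast
    then have "Inf {y\<in>I. E.e y < 0} \<le> z"
      by (intro cInf_lower E.bdd_below_neg) auto
    also have "z \<le> Max (set x)"
      using F.le_Max[OF F z(1)] .
    finally show ?thesis
      by (simp only: E.D_lower_eq_Inf[OF False] F.D_lower_eq_Max[OF F])
  qed
next
  case F: False
  then have E: "{y\<in>I. E.e y < 0} \<noteq> {}"
    using neg by blast
  show ?thesis
    unfolding E.D_lower_eq_Inf[OF E] F.D_lower_eq_Inf[OF F]
    using F neg by (intro cInf_superset_mono E.bdd_below_neg) auto
qed

text \<open>Dual case distinction: if \<open>E.e\<close> is never positive, the mean of
  \<open>E\<close> is the left endpoint of \<open>I\<close>; otherwise both sets are nonempty and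
  nested.\<close>

lemma D_upper_mono: "D_upper I E x l \<le> D_upper I F x l"
proof (cases "{y\<in>I. E.e y > 0} = {}")
  case E: True
  show ?thesis
  proof (cases "{y\<in>I. F.e y > 0} = {}")
    case True
    then show ?thesis
      by (simp only: F.D_upper_eq_Min E.D_upper_eq_Min[OF E] order_refl)
  next
    case False
    then obtain z where z: "z \<in> I" "F.e z > 0"
      by blast
    have "Min (set x) \<le> z"
      using E.Min_le[OF E z(1)] .
    also have "z \<le> Sup {y\<in>I. F.e y > 0}"
      using z by (intro cSup_upper F.bdd_above_pos) auto
    finally show ?thesis
      by (simp only: F.D_upper_eq_Sup[OF False] E.D_upper_eq_Min[OF E])
  qed
next
  case E: False
  have sub: "{y\<in>I. E.e y > 0} \<subseteq> {y\<in>I. F.e y > 0}"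
    using nonpos by (force simp: not_le[symmetric])
  then have F: "{y\<in>I. F.e y > 0} \<noteq> {}"
    using E by blast
  show ?thesis
    unfolding E.D_upper_eq_Sup[OF E] F.D_upper_eq_Sup[OF F]
    using E sub by (intro cSup_subset_mono F.bdd_above_pos)
qed

end

section \<open>Sign of a slightly perturbed deviation, to first order\<close>

text \<open>
  Near \<open>y\<close> the combination \<open>t g + h\<close> is about \<open>t g(y) - d (u - y)\<close>, whose zero \<open>y + t g(y) / d\<close>
  lies above \<open>y + t c\<close>; away from \<open>y\<close> and above \<open>x\<close>, compactness bounds \<open>h\<close> below by a positive
  constant, which dominates \<open>t g\<close>.
\<close>

lemma eventually_pos_below:
  fixes g h :: "real \<Rightarrow> real"
  assumes I: "is_interval I" "x \<in> I" "y \<in> I"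
    and cont: "continuous_on I g" "continuous_on I h"
    and g: "\<And>u. \<lbrakk>u \<in> I; u \<le> x\<rbrakk> \<Longrightarrow> g u \<ge> 0"
    and h: "\<And>u. \<lbrakk>u \<in> I; u < y\<rbrakk> \<Longrightarrow> h u > 0" "h y = 0"
    and deriv: "(h has_real_derivative - d) (at y within I)"
    and d: "d > 0" "c * d < g y"
  shows "\<forall>\<^sub>F t in at_right 0. \<forall>u\<in>I. u < y + t * c \<longrightarrow> t * g u + h u > 0"
proof -
  \<comment> \<open>The first bound keeps the error slope below \<open>d\<close>. The second leaves
    a positive margin after the error \<open>t * \<epsilon>\<close> from \<open>g\<close> and
    \<open>\<epsilon> * \<bar>t * c\<bar>\<close> from \<open>h\<close>.\<close>
  define \<epsilon> where "\<epsilon> = min (d / 2) ((g y - c * d) / (2 * (1 + \<bar>c\<bar>)))"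
  have \<epsilon>: "\<epsilon> > 0" "\<epsilon> < d" "\<epsilon> * (1 + \<bar>c\<bar>) < g y - c * d"
  proof -
    show "\<epsilon> > 0" "\<epsilon> < d"
      using d by (auto simp: \<epsilon>_def add_pos_nonneg)
    have "\<epsilon> * (1 + \<bar>c\<bar>) \<le> (g y - c * d) / (2 * (1 + \<bar>c\<bar>)) * (1 + \<bar>c\<bar>)"
      by (intro mult_right_mono) (auto simp: \<epsilon>_def)
    also have "\<dots> = (g y - c * d) / 2"
      by (simp add: field_simps add_pos_nonneg)
    also have "\<dots> < g y - c * d"
      using d by simp
    finally show "\<epsilon> * (1 + \<bar>c\<bar>) < g y - c * d" .
  qed
  obtain \<delta>1 where \<delta>1: "\<delta>1 > 0" "\<And>u. \<lbrakk>u \<in> I; \<bar>u - y\<bar> < \<delta>1\<rbrakk> \<Longrightarrow> \<bar>g u - g y\<bar> < \<epsilon>"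
    using cont(1) I(3) \<epsilon>(1) unfolding continuous_on_iff dist_real_def by meson
  obtain \<delta>2 where \<delta>2: "\<delta>2 > 0"
    "\<And>u. \<lbrakk>u \<in> I; \<bar>u - y\<bar> < \<delta>2\<rbrakk> \<Longrightarrow> \<bar>h u - h y - (- d) * (u - y)\<bar> \<le> \<epsilon> * \<bar>u - y\<bar>"
    using deriv \<epsilon>(1) unfolding has_field_derivative_def has_derivative_within_alt
    by (fastforce simp: real_norm_def)
  \<comment> \<open>Halving lets the closed \<open>\<delta>\<close>-neighbourhood fit into both open
    ones.\<close>
  define \<delta> where "\<delta> = min \<delta>1 \<delta>2 / 2"
  have \<delta>: "\<delta> > 0" "\<delta> < \<delta>1" "\<delta> < \<delta>2"
    using \<delta>1(1) \<delta>2(1) by (auto simp: \<delta>_def)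
  have near: "t * g u + h u > 0"
    if "u \<in> I" "\<bar>u - y\<bar> \<le> \<delta>" "u < y + t * c" "t > 0" for t u
  proof -
    have "g u > g y - \<epsilon>"
      using \<delta>1(2)[of u] that \<delta> by fastforce
    then have "t * g u > t * (g y - \<epsilon>)"
      using \<open>t > 0\<close> by simp
    moreover have "h u \<ge> - d * (u - y) - \<epsilon> * \<bar>u - y\<bar>"
      using \<delta>2(2)[of u] that \<delta> h(2) by fastforce
    \<comment> \<open>Since \<open>\<epsilon> < d\<close>, the lower bound for \<open>h u\<close> is
      decreasing in \<open>u\<close>, so it may be evaluated at \<open>y + t * c\<close> instead of
      \<open>u\<close>.\<close>
    moreover have "- d * (u - y) - \<epsilon> * \<bar>u - y\<bar> \<ge> - d * (t * c) - \<epsilon> * \<bar>t * c\<bar>"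
    proof -
      have "\<bar>t * c\<bar> - \<bar>u - y\<bar> \<ge> - (t * c - (u - y))"
        using that(3) by linarith
      then have "\<epsilon> * (\<bar>t * c\<bar> - \<bar>u - y\<bar>) \<ge> \<epsilon> * - (t * c - (u - y))"
        using \<epsilon>(1) by (intro mult_left_mono) auto
      moreover have "d * (t * c - (u - y)) \<ge> \<epsilon> * (t * c - (u - y))"
        using \<epsilon>(2) that(3) by (intro mult_right_mono) auto
      ultimately show ?thesis
        by (simp add: algebra_simps)
    qed
    moreover have "t * (g y - \<epsilon>) - d * (t * c) - \<epsilon> * \<bar>t * c\<bar> = t * ((g y - c * d) - \<epsilon> * (1 + \<bar>c\<bar>))"
      using \<open>t > 0\<close> by (simp add: algebra_simps abs_mult)
    moreover have "t * ((g y - c * d) - \<epsilon> * (1 + \<bar>c\<bar>)) > 0"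
      using \<open>t > 0\<close> \<epsilon>(3) by simp
    ultimately show ?thesis
      by linarith
  qed
  \<comment> \<open>Between \<open>x\<close> and \<open>y - \<delta>\<close> the function
    \<open>g\<close> may be negative, so \<open>t\<close> must be small compared with the minimum of
    \<open>h\<close> there. If this segment is empty, any \<open>t0\<close> serves.\<close>
  have "\<exists>t0>0. \<forall>t. 0 < t \<and> t < t0 \<longrightarrow> (\<forall>u\<in>{x..y - \<delta>}. t * g u + h u > 0)"
  proof (cases "x \<le> y - \<delta>")
    case True
    have sub: "{x..y - \<delta>} \<subseteq> I"
      using I \<delta>(1) by (auto intro!: mem_is_interval_1_I[of I x y])
    have cont': "continuous_on {x..y - \<delta>} g" "continuous_on {x..y - \<delta>} h"
      using cont sub by (auto intro: continuous_on_subset)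
    obtain p where p: "p \<in> {x..y - \<delta>}" "\<And>u. u \<in> {x..y - \<delta>} \<Longrightarrow> h p \<le> h u"
      using continuous_attains_inf[OF _ _ cont'(2)] True by auto
    obtain q where q: "q \<in> {x..y - \<delta>}" "\<And>u. u \<in> {x..y - \<delta>} \<Longrightarrow> g q \<le> g u"
      using continuous_attains_inf[OF _ _ cont'(1)] True by auto
    have "h p > 0"
      using p(1) sub \<delta>(1) by (intro h) auto
    show ?thesis
    \<comment> \<open>For such \<open>t\<close> the product \<open>t * \<bar>g q\<bar>\<close> stays
      below the minimum \<open>h p\<close>; the summand 1 keeps the denominator positive.\<close>
    proof (intro exI[of _ "h p / (1 + \<bar>g q\<bar>)"] conjI allI impI ballI)
      show "h p / (1 + \<bar>g q\<bar>) > 0"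
        using \<open>h p > 0\<close> by (simp add: add_pos_nonneg)
      fix t u assume t: "0 < t \<and> t < h p / (1 + \<bar>g q\<bar>)" and u: "u \<in> {x..y - \<delta>}"
      have "t * (1 + \<bar>g q\<bar>) < h p"
        using t by (simp add: pos_less_divide_eq add_pos_nonneg)
      moreover have "t * g u \<ge> t * - \<bar>g q\<bar>"
        using t q(2)[OF u] by (intro mult_left_mono) auto
      ultimately show "t * g u + h u > 0"
        using p(2)[OF u] t by (simp add: algebra_simps)
    qed
  qed (auto intro: exI[of _ 1])
  then obtain t0 where t0: "t0 > 0"
    "\<And>t u. \<lbrakk>0 < t; t < t0; u \<in> {x..y - \<delta>}\<rbrakk> \<Longrightarrow> t * g u + h u > 0"
    by blast
  \<comment> \<open>The second bound yields \<open>t * c \<le> \<delta>\<close>, so every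
    \<open>u < y + t * c\<close> with \<open>u \<ge> y - \<delta>\<close> is within
    \<open>\<delta>\<close> of \<open>y\<close>.\<close>
  have "\<forall>\<^sub>F t in at_right 0. 0 < t \<and> t < min t0 (\<delta> / (1 + \<bar>c\<bar>))"
    using eventually_at_right_real[of 0 "min t0 (\<delta> / (1 + \<bar>c\<bar>))"] t0(1) \<delta>(1)
    by (simp add: add_pos_nonneg)
  then show ?thesis
  proof eventually_elim
    case (elim t)
    then have t: "0 < t" "t < t0" "t * (1 + \<bar>c\<bar>) < \<delta>"
      by (auto simp: pos_less_divide_eq add_pos_nonneg)
    have tc: "t * c \<le> \<delta>"
    proof -
      have "t * c \<le> t * (1 + \<bar>c\<bar>)"
        using t(1) by (intro mult_left_mono) auto
      with t(3) show ?thesis by simp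
    qed
    show ?case
    proof (intro ballI impI)
      fix u assume u: "u \<in> I" "u < y + t * c"
      \<comment> \<open>The first range is covered by \<open>near\<close>, the second by signs alone
        (\<open>g \<ge> 0\<close> and \<open>h > 0\<close>), the compact third by
        \<open>t0\<close>.\<close>
      consider "u \<ge> y - \<delta>" | "u < y - \<delta>" "u \<le> x" | "u \<in> {x..y - \<delta>}"
        by fastforce
      then show "t * g u + h u > 0"
      proof cases
        case 1
        then show ?thesis
          using u t(1) tc by (intro near) auto
      next
        case 2
        then show ?thesis
          using g[of u] h(1)[of u] u(1) t(1) \<delta>(1) by (intro add_nonneg_pos) auto
      next
        case 3
        then show ?thesis
          using t by (intro t0)
      qed
    qed
  qed
qed

text \<open>Reflection: \<open>eventually_pos_below\<close> is applied to \<open>- g (- u)\<close>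
  and \<open>- h (- u)\<close> with \<open>x\<close>, \<open>y\<close>, \<open>c\<close> negated.
  The two sign changes cancel in the derivative, so \<open>d\<close> is kept.\<close>

lemma eventually_neg_above:
  fixes g h :: "real \<Rightarrow> real"
  assumes I: "is_interval I" "x \<in> I" "y \<in> I"
    and cont: "continuous_on I g" "continuous_on I h"
    and g: "\<And>u. \<lbrakk>u \<in> I; u \<ge> x\<rbrakk> \<Longrightarrow> g u \<le> 0"
    and h: "\<And>u. \<lbrakk>u \<in> I; u > y\<rbrakk> \<Longrightarrow> h u < 0" "h y = 0"
    and deriv: "(h has_real_derivative - d) (at y within I)"
    and d: "d > 0" "c * d > g y"
  shows "\<forall>\<^sub>F t in at_right 0. \<forall>u\<in>I. u > y + t * c \<longrightarrow> t * g u + h u < 0"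
proof -
  let ?J = "uminus ` I"
  have "\<forall>\<^sub>F t in at_right 0. \<forall>u\<in>?J. u < - y + t * - c \<longrightarrow> t * (- g (- u)) + (- h (- u)) > 0"
  proof (rule eventually_pos_below[where x = "- x" and d = d])
    show "is_interval ?J" "- x \<in> ?J" "- y \<in> ?J"
      using I by (auto simp: is_interval_neg_translationI)
    show "continuous_on ?J (\<lambda>u. - g (- u))" "continuous_on ?J (\<lambda>u. - h (- u))"
      using cont by (auto intro!: continuous_intros continuous_on_compose2[of I g]
          continuous_on_compose2[of I h])
    have "((\<lambda>u. h (- u)) has_real_derivative (- d) * (- 1)) (at (- y) within ?J)"
      by (rule DERIV_image_chain[of h _ uminus, unfolded o_def])
        (use deriv in \<open>auto intro!: derivative_eq_intros simp: image_image\<close>)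
    from DERIV_minus[OF this]
    show "((\<lambda>u. - h (- u)) has_real_derivative - d) (at (- y) within ?J)"
      by simp
  qed (use g h d in auto)
  then show ?thesis
    by eventually_elim (force simp: algebra_simps)
qed

section \<open>Consequences of normalizability and sufficiency\<close>

text \<open>At an interior point \<open>E p\<close> is nonnegative on the left and nonpositive on
  the right, and by continuity both one-sided limits equal \<open>E p p\<close>. At endpoints the
  value is part of the definition.\<close>

lemma normalizable_diag:
  assumes "normalizable I E" "p \<in> I"
  shows "E p p = 0"
proof (cases "p \<in> interior I")
  case True
  have lim: "(E p \<longlongrightarrow> E p p) (at p)"
    using assms True continuous_on_interior[of I "E p" p]
    by (auto simp: normalizable_def isCont_def)
  have ev: "\<forall>\<^sub>F u in at p within S. u \<in> I" for S
    using True by (auto simp: eventually_at_topological intro!: exI[of _ "interior I"]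
        dest: subsetD[OF interior_subset])
  have sgn: "sgn (E p u) = sgn (p - u)" if "u \<in> I" "u \<noteq> p" for u
    using assms that by (auto simp: normalizable_def semideviation_def)
  have left: "\<forall>\<^sub>F u in at_left p. u \<in> {p - 1<..<p}"
    by (rule eventually_at_left_real) simp
  have "\<forall>\<^sub>F u in at_left p. E p u \<ge> 0"
    using ev left by eventually_elim (use sgn in \<open>force simp: sgn_if split: if_splits\<close>)
  moreover have "\<forall>\<^sub>F u in at_right p. E p u \<le> 0"
    using ev eventually_at_right_less
    by eventually_elim (use sgn in \<open>force simp: sgn_if split: if_splits\<close>)
  moreover have "(E p \<longlongrightarrow> E p p) (at_left p)" "(E p \<longlongrightarrow> E p p) (at_right p)"
    using lim by (simp_all add: filterlim_at_split)
  ultimately show ?thesis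
    by (intro antisym tendsto_lowerbound[of "E p" "E p p" "at_left p"]
        tendsto_upperbound[of "E p" "E p p" "at_right p"]) auto
qed (use assms in \<open>auto simp: normalizable_def\<close>)

text \<open>The double minus matches the slope \<open>- d\<close> of
  \<open>eventually_pos_below\<close>, with the positive number
  \<open>d = - partial2_diag I E p\<close>.\<close>

lemma normalizable_deriv:
  assumes "normalizable I E" "p \<in> I"
  shows "(E p has_real_derivative - (- partial2_diag I E p)) (at p within I)"
  using assms
  unfolding normalizable_def partial2_diag_def has_real_derivative_iff_has_vector_derivative
    minus_minus vector_derivative_works
  by blast

lemma sampleI:
  assumes "is_interval I" "normalizable I E" "(x, l) \<in> weighted_samples I"
  shows "sample I E x l"
proof
  show "E p p = 0" if "p \<in> I" for p
    using assms(2) that by (rule normalizable_diag)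
qed (use assms in \<open>auto simp: normalizable_def\<close>)

text \<open>The normalizing factor depends on \<open>y\<close> only, so it leaves the sum; being
  positive, it does not affect the sign.\<close>

lemma weighted_dev_normalization:
  assumes "normalizable I E" "y \<in> I"
  shows "weighted_dev E x l y = - partial2_diag I E y * weighted_dev (normalization I E) x l y"
proof -
  have "partial2_diag I E y < 0"
    using assms by (simp add: normalizable_def)
  then show ?thesis
    by (simp add: weighted_dev_def normalization_def sum_distrib_left)
qed

text \<open>Nonnegative weights carry the pointwise inequality over to the normalized sums. The
  factors of \<open>E\<close> and \<open>F\<close> may differ, but both are positive, so the sign
  implications survive.\<close>

lemma ordered_samplesI:
  assumes I: "is_interval I" and E: "normalizable I E" and F: "normalizable I F"
    and le: "\<And>p q. \<lbrakk>p \<in> I; q \<in> I\<rbrakk> \<Longrightarrow> normalization I E p q \<le> normalization I F p q"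
    and xl: "(x, l) \<in> weighted_samples I"
  shows "ordered_samples I E F x l"
proof -
  interpret E: sample I E x l using I E xl by (rule sampleI)
  interpret F: sample I F x l using I F xl by (rule sampleI)
  have le': "weighted_dev (normalization I E) x l y \<le> weighted_dev (normalization I F) x l y"
    if "y \<in> I" for y
    unfolding weighted_dev_def
    using that by (intro sum_mono mult_left_mono le E.nth_in E.weight_nonneg) auto
  show ?thesis
  proof
    fix y assume y: "y \<in> I"
    have neg: "partial2_diag I E y < 0" "partial2_diag I F y < 0"
      using E F y by (auto simp: normalizable_def)
    show "E.e y \<le> 0" if "F.e y \<le> 0"
      using that neg le'[OF y]
      by (simp add: weighted_dev_normalization[OF E y] weighted_dev_normalization[OF F y]
          zero_le_mult_iff)
    show "E.e y < 0" if "F.e y < 0"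
      using that neg le'[OF y]
      by (simp add: weighted_dev_normalization[OF E y] weighted_dev_normalization[OF F y]
          zero_less_mult_iff)
  qed
qed

section \<open>Necessity by two-point samples\<close>

lemma normalization_le_if_D_le:
  assumes I: "is_interval I" and E: "normalizable I E" and F: "normalizable I F"
    and D: "\<And>x l. (x, l) \<in> weighted_samples I \<Longrightarrow> D_lower_lower I E x l \<le> D_upper_upper I F x l"
    and xy: "x \<in> I" "y \<in> I"
  shows "normalization I E x y \<le> normalization I F x y"
proof (rule ccontr)
  assume "\<not> ?thesis"
  then have "normalization I F x y < normalization I E x y"
    by simp
  \<comment> \<open>Two separating slopes are taken because the bounds on the means are nonstrict:
    the mean of \<open>E\<close> will be at least \<open>y + t * c'\<close> and that of
    \<open>F\<close> at most \<open>y + t * c\<close>.\<close>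
  then obtain c c' where c: "normalization I F x y < c" "c < c'" "c' < normalization I E x y"
    using dense by meson
  have neg: "- partial2_diag I E y > 0" "- partial2_diag I F y > 0"
    using E F xy by (auto simp: normalizable_def)
  have sample: "([x, y], [t, 1]) \<in> weighted_samples I" if "t > 0" for t
    using that xy by (auto simp: weighted_samples_def weights_def less_Suc_eq nth_Cons'
        intro!: exI[of _ 2])
  \<comment> \<open>The weights \<open>[1, 1]\<close> only give access to \<open>dev_pos\<close>,
    \<open>dev_neg\<close> and \<open>diag\<close>, which do not depend on the weights.\<close>
  interpret E: sample I E "[x, y]" "[1, 1]" using I E sample[of 1] by (intro sampleI) auto
  interpret F: sample I F "[x, y]" "[1, 1]" using I F sample[of 1] by (intro sampleI) auto
  have cont: "continuous_on I (G p)" if "normalizable I G" "p \<in> I" for G p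
    using that by (simp add: normalizable_def)
  have "\<forall>\<^sub>F t in at_right 0. \<forall>u\<in>I. u < y + t * c' \<longrightarrow> t * E x u + E y u > 0"
  proof (rule eventually_pos_below[OF I xy cont[OF E xy(1)] cont[OF E xy(2)] _ _ _
        normalizable_deriv[OF E xy(2)] neg(1)])
    show "E x u \<ge> 0" if "u \<in> I" "u \<le> x" for u
      using E.dev_pos[OF xy(1) that(1)] E.diag[OF xy(1)] that(2) by (cases "u = x") auto
    show "c' * - partial2_diag I E y < E x y"
      using c(3) neg(1) by (simp only: normalization_def pos_less_divide_eq)
  qed (use E.dev_pos E.diag xy in auto)
  moreover have "\<forall>\<^sub>F t in at_right 0. \<forall>u\<in>I. u > y + t * c \<longrightarrow> t * F x u + F y u < 0"
  proof (rule eventually_neg_above[OF I xy cont[OF F xy(1)] cont[OF F xy(2)] _ _ _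
        normalizable_deriv[OF F xy(2)] neg(2)])
    show "F x u \<le> 0" if "u \<in> I" "u \<ge> x" for u
      using F.dev_neg[OF xy(1) that(1)] F.diag[OF xy(1)] that(2) by (cases "u = x") auto
    show "c * - partial2_diag I F y > F x y"
      using c(1) neg(2) by (simp only: normalization_def pos_divide_less_eq)
  qed (use F.dev_neg F.diag xy in auto)
  moreover have "\<forall>\<^sub>F t in at_right (0::real). t > 0"
    by (rule eventually_at_right_less)
  \<comment> \<open>The filter \<open>at_right 0\<close> is nontrivial, so a contradiction for all
    small \<open>t > 0\<close> is a contradiction outright.\<close>
  ultimately have "\<forall>\<^sub>F t in at_right (0::real). False"
  proof eventually_elim
    case (elim t)
    interpret Et: sample I E "[x, y]" "[t, 1]" using I E sample[OF elim(3)] by (rule sampleI)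
    interpret Ft: sample I F "[x, y]" "[t, 1]" using I F sample[OF elim(3)] by (rule sampleI)
    have "y + t * c' \<le> D_lower_lower I E [x, y] [t, 1]"
      using elim(1) by (intro Et.D_lower_lower_ge) (simp add: weighted_dev_def)
    also have "\<dots> \<le> D_upper_upper I F [x, y] [t, 1]"
      using D sample[OF elim(3)] .
    also have "\<dots> \<le> y + t * c"
      using elim(2) by (intro Ft.D_upper_upper_le) (simp add: weighted_dev_def)
    finally show False
      using c(2) elim(3) by simp
  qed
  then show False
    by (simp add: eventually_False)
qed

theorem theorem5p3:
  fixes I :: "real set" and E F :: "real \<Rightarrow> real \<Rightarrow> real"
  assumes "is_interval I" and "normalizable I E" and "normalizable I F"
  shows
    "((\<forall>x\<in>I. \<forall>y\<in>I. normalization I E x y \<le> normalization I F x y) \<longrightarrow>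
        (\<forall>(x, l)\<in>weighted_samples I. D_lower_lower I E x l \<le> D_lower_lower I F x l) \<and>
        (\<forall>(x, l)\<in>weighted_samples I. D_lower I E x l \<le> D_lower I F x l) \<and>
        (\<forall>(x, l)\<in>weighted_samples I. D_upper I E x l \<le> D_upper I F x l) \<and>
        (\<forall>(x, l)\<in>weighted_samples I. D_upper_upper I E x l \<le> D_upper_upper I F x l)) \<and>
     ((\<forall>(x, l)\<in>weighted_samples I. D_lower_lower I E x l \<le> D_upper_upper I F x l) \<longrightarrow>
        (\<forall>x\<in>I. \<forall>y\<in>I. normalization I E x y \<le> normalization I F x y)) \<and>
     ((\<forall>(x, l)\<in>weighted_samples I. D_lower_lower I E x l \<le> D_lower_lower I F x l) \<or>
      (\<forall>(x, l)\<in>weighted_samples I. D_lower I E x l \<le> D_lower I F x l) \<or>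
      (\<forall>(x, l)\<in>weighted_samples I. D_upper I E x l \<le> D_upper I F x l) \<or>
      (\<forall>(x, l)\<in>weighted_samples I. D_upper_upper I E x l \<le> D_upper_upper I F x l) \<longrightarrow>
        (\<forall>x\<in>I. \<forall>y\<in>I. normalization I E x y \<le> normalization I F x y))"
proof (intro conjI)
  have E: "sample I E x l" and F: "sample I F x l" if "(x, l) \<in> weighted_samples I" for x l
    using assms that by (auto intro: sampleI)
  show "(\<forall>x\<in>I. \<forall>y\<in>I. normalization I E x y \<le> normalization I F x y) \<longrightarrow>
        (\<forall>(x, l)\<in>weighted_samples I. D_lower_lower I E x l \<le> D_lower_lower I F x l) \<and>
        (\<forall>(x, l)\<in>weighted_samples I. D_lower I E x l \<le> D_lower I F x l) \<and>
        (\<forall>(x, l)\<in>weighted_samples I. D_upper I E x l \<le> D_upper I F x l) \<and>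
        (\<forall>(x, l)\<in>weighted_samples I. D_upper_upper I E x l \<le> D_upper_upper I F x l)"
  proof
    assume "\<forall>x\<in>I. \<forall>y\<in>I. normalization I E x y \<le> normalization I F x y"
    then have "ordered_samples I E F x l" if "(x, l) \<in> weighted_samples I" for x l
      using assms that by (intro ordered_samplesI) auto
    then show "(\<forall>(x, l)\<in>weighted_samples I. D_lower_lower I E x l \<le> D_lower_lower I F x l) \<and>
        (\<forall>(x, l)\<in>weighted_samples I. D_lower I E x l \<le> D_lower I F x l) \<and>
        (\<forall>(x, l)\<in>weighted_samples I. D_upper I E x l \<le> D_upper I F x l) \<and>
        (\<forall>(x, l)\<in>weighted_samples I. D_upper_upper I E x l \<le> D_upper_upper I F x l)"
      by (auto intro: ordered_samples.D_lower_lower_mono ordered_samples.D_lower_mono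
          ordered_samples.D_upper_mono ordered_samples.D_upper_upper_mono)
  qed
  show necessary: "(\<forall>(x, l)\<in>weighted_samples I. D_lower_lower I E x l \<le> D_upper_upper I F x l) \<longrightarrow>
        (\<forall>x\<in>I. \<forall>y\<in>I. normalization I E x y \<le> normalization I F x y)"
    using normalization_le_if_D_le[OF assms] by blast
  show "(\<forall>(x, l)\<in>weighted_samples I. D_lower_lower I E x l \<le> D_lower_lower I F x l) \<or>
      (\<forall>(x, l)\<in>weighted_samples I. D_lower I E x l \<le> D_lower I F x l) \<or>
      (\<forall>(x, l)\<in>weighted_samples I. D_upper I E x l \<le> D_upper I F x l) \<or>
      (\<forall>(x, l)\<in>weighted_samples I. D_upper_upper I E x l \<le> D_upper_upper I F x l) \<longrightarrow>
        (\<forall>x\<in>I. \<forall>y\<in>I. normalization I E x y \<le> normalization I F x y)"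
    (is "?LL \<or> ?L \<or> ?U \<or> ?UU \<longrightarrow> _")
  proof
    assume *: "?LL \<or> ?L \<or> ?U \<or> ?UU"
    \<comment> \<open>Whichever mean is compared, the mean of \<open>E\<close> is at least
      \<open>D_lower_lower\<close> of \<open>E\<close> and the mean of \<open>F\<close> at most
      \<open>D_upper_upper\<close> of \<open>F\<close>.\<close>
    have "D_lower_lower I E x l \<le> D_upper_upper I F x l" if xl: "(x, l) \<in> weighted_samples I" for x l
    proof -
      interpret E: sample I E x l using xl by (rule E)
      interpret F: sample I F x l using xl by (rule F)
      from * xl consider "D_lower_lower I E x l \<le> D_lower_lower I F x l"
        | "D_lower I E x l \<le> D_lower I F x l" | "D_upper I E x l \<le> D_upper I F x l"
        | "D_upper_upper I E x l \<le> D_upper_upper I F x l"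
        by blast
      then show ?thesis
        using E.D_lower_lower_le_D_lower E.D_lower_lower_le_D_upper
          E.D_lower_lower_le_D_upper_upper F.D_lower_lower_le_D_upper_upper
          F.D_lower_le_D_upper_upper F.D_upper_le_D_upper_upper
        by cases linarith+
    qed
    then show "\<forall>x\<in>I. \<forall>y\<in>I. normalization I E x y \<le> normalization I F x y"
      using necessary by blast
  qed
qed

end
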